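(* Let $m,q\geq 2$ be integers and let $\lambda=(a_k,a_{k-1},\ldots,a_0)_m$ be a conjugate $(m,q)$-ary partition. Then $\lambda$ is generated by a unique (finite, possibly empty) sequence of $R_{mq}$ and $M_{mq}$ operators applied to the trivial partition $(1)_m$ of $1$. Also, $\lambda$ is generated by a unique (finite, possibly empty) sequence of $S_{mq}$ and $J_{mq}$ operators applied to $(1)_m$.
   Context: Let $m,q\ge 2$ be integers. A partition $\lambda$ of a positive integer $n$ is $m$-ary if all its parts are powers $m^i$, $i\ge 0$ (so $m^0=1$ is allowed). If $a_i$ is the number of times the part $m^i$ appears in $\lambda$, one writes $\lambda=(a_k,a_{k-1},\ldots,a_0)_m$, where $a_k\neq 0$ and $a_i=0$ for $i>k$. The conjugate $\lambda'$ is obtained by reflecting the Ferrers diagram across the main diagonal. $\lambda$ is conjugate $(m,q)$-ary if $\lambda$ is $m$-ary and $\lambda'$ is $q$-ary; equivalently, $\lambda$ is $m$-ary and each partial sum $\sum_{i=r}^k a_i$, $0\le r\le k$, is a power of $q$ (with $q^0=1$ allowed). For a conjugate $(m,q)$-ary partition $\lambda=(a_k,\ldots,a_0)_m$ with $\sum_{i=0}^k a_i=q^t$, define the operators (each producing a conjugate $(m,q)$-ary partition): raise $R_{mq}(\lambda)=(qa_k,qa_{k-1},\ldots,qa_0)_m$; migration $M_{mq}(\lambda)=(1,a_k-1,a_{k-1},\ldots,a_0)_m$; shift $S_{mq}(\lambda)=(a_k,a_{k-1},\ldots,a_0,0)_m$; jump $J_{mq}(\lambda)=(a_k,\ldots,a_1,a_0+q^{t+1}-q^t)_m$.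 Sequences of operators are composed as functions (rightmost applied first). *)

theory Defs
  imports Main "HOL-Library.Multiset"
begin

section \<open>Partitions, Ferrers diagrams and conjugation\<close>

definition partition_of :: "nat \<Rightarrow> nat multiset \<Rightarrow> bool" where
  "partition_of n \<mu> \<longleftrightarrow> 0 \<notin># \<mu> \<and> sum_mset \<mu> = n"

text \<open>The cell \<open>(i, j)\<close> is in row \<open>i\<close> and column \<open>j\<close>, both counted from 0.\<close>

definition ferrers :: "nat multiset \<Rightarrow> (nat \<times> nat) set" where
  "ferrers \<mu> = {(i, j). i < size \<mu> \<and> j < rev (sorted_list_of_multiset \<mu>) ! i}"

definition row_lengths :: "(nat \<times> nat) set \<Rightarrow> nat multiset" where
  "row_lengths D = image_mset (\<lambda>i. card (D `` {i})) (mset_set (Domain D))"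

definition conjugate :: "nat multiset \<Rightarrow> nat multiset" where
  "conjugate \<mu> = row_lengths ((ferrers \<mu>)\<inverse>)"

lemma row_lengths_ferrers:
  assumes "0 \<notin># \<mu>"
  shows "row_lengths (ferrers \<mu>) = \<mu>"
proof -
  define xs where "xs = rev (sorted_list_of_multiset \<mu>)"
  have mset_xs: "mset xs = \<mu>" by (simp add: xs_def)
  have len: "length xs = size \<mu>" by (metis mset_xs size_mset)
  have pos: "xs ! i > 0" if "i < size \<mu>" for i
    using that assms len mset_xs by (metis gr0I nth_mem set_mset_mset)
  have dom: "Domain (ferrers \<mu>) = {..<size \<mu>}"
    using pos by (auto simp: ferrers_def xs_def)
  have row: "card (ferrers \<mu> `` {i}) = xs ! i" if "i < size \<mu>" for i
  proof -
    have "ferrers \<mu> `` {i} = {..<xs ! i}"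
      using that by (auto simp: ferrers_def xs_def)
    then show ?thesis by simp
  qed
  have "row_lengths (ferrers \<mu>) = image_mset ((!) xs) (mset_set {..<size \<mu>})"
    unfolding row_lengths_def dom by (rule image_mset_cong) (simp add: row)
  also have "mset_set {..<size \<mu>} = mset [0..<length xs]"
    by (simp add: len lessThan_atLeast0)
  also have "image_mset ((!) xs) (mset [0..<length xs]) = mset xs"
    by (metis map_nth mset_map)
  finally show ?thesis by (simp add: mset_xs)
qed

definition ary :: "nat \<Rightarrow> nat multiset \<Rightarrow> bool" where
  "ary m \<mu> \<longleftrightarrow> (\<exists>n>0. partition_of n \<mu>) \<and> (\<forall>p\<in>#\<mu>. \<exists>i. p = m ^ i)"

definition conjugate_ary :: "nat \<Rightarrow> nat \<Rightarrow> nat multiset \<Rightarrow> bool" where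
  "conjugate_ary m q \<mu> \<longleftrightarrow> ary m \<mu> \<and> ary q (conjugate \<mu>)"


section \<open>Multiplicity notation\<close>

text \<open>\<open>from_mults m [a\<^sub>k, \<dots>, a\<^sub>0]\<close> is the partition \<open>(a\<^sub>k, \<dots>, a\<^sub>0)\<^sub>m\<close>, and \<open>mults m \<mu>\<close> recovers
  the list \<open>[a\<^sub>k, \<dots>, a\<^sub>0]\<close>, with \<open>a\<^sub>k \<noteq> 0\<close>, from an \<open>m\<close>-ary partition \<open>\<mu>\<close>.\<close>

primrec from_mults :: "nat \<Rightarrow> nat list \<Rightarrow> nat multiset" where
  "from_mults m [] = {#}"
| "from_mults m (a # as) = replicate_mset a (m ^ length as) + from_mults m as"

definition mults :: "nat \<Rightarrow> nat multiset \<Rightarrow> nat list" where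
  "mults m \<mu> = map (\<lambda>i. count \<mu> (m ^ i)) (rev [0..<Suc (Max {i. m ^ i \<in># \<mu>})])"

lemma count_from_mults_map:
  assumes "m \<ge> 2"
  shows "count (from_mults m (map f (rev [0..<n]))) p = (\<Sum>i<n. if p = m ^ i then f i else 0)"
  by (induction n) auto

lemma from_mults_mults:
  assumes "m \<ge> 2" and "ary m \<mu>"
  shows "from_mults m (mults m \<mu>) = \<mu>"
proof (rule multiset_eqI)
  fix p
  have inj: "m ^ i = m ^ j \<longleftrightarrow> i = j" for i j
    using assms(1) by simp
  define k where "k = Max {i. m ^ i \<in># \<mu>}"
  have "finite ((\<lambda>i. m ^ i) -` set_mset \<mu>)"
    by (rule finite_vimageI) (auto simp: inj_def inj)
  then have fin: "finite {i. m ^ i \<in># \<mu>}"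
    by (simp add: vimage_def)
  have c: "count (from_mults m (mults m \<mu>)) p
      = (\<Sum>i<Suc k. if p = m ^ i then count \<mu> (m ^ i) else 0)"
    unfolding mults_def k_def by (rule count_from_mults_map[OF assms(1)])
  show "count (from_mults m (mults m \<mu>)) p = count \<mu> p"
  proof (cases "p \<in># \<mu>")
    case True
    then obtain i where i: "p = m ^ i"
      using assms(2) by (auto simp: ary_def)
    with True have "i \<le> k"
      unfolding k_def using fin by (intro Max_ge) auto
    then show ?thesis
      unfolding c by (simp add: i inj sum.delta' del: sum.lessThan_Suc)
  next
    case False
    then have "count \<mu> p = 0" by (simp add: not_in_iff)
    then show ?thesis unfolding c by (intro trans[OF sum.neutral]) auto
  qed
qed


section \<open>The operators\<close>

text \<open>The operators are meant for conjugate \<open>(m, q)\<close>-ary partitions only. There \<open>a\<^sub>k \<ge> 1\<close>, so the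
  truncated subtraction in \<open>migration\<close> is harmless, and the exponent \<open>t\<close> in \<open>jump\<close> exists.\<close>

definition raise :: "nat \<Rightarrow> nat \<Rightarrow> nat multiset \<Rightarrow> nat multiset" where
  "raise m q \<mu> = from_mults m (map (\<lambda>a. q * a) (mults m \<mu>))"

definition migration :: "nat \<Rightarrow> nat \<Rightarrow> nat multiset \<Rightarrow> nat multiset" where
  "migration m q \<mu> = (let as = mults m \<mu> in from_mults m (1 # (hd as - 1) # tl as))"

definition shift :: "nat \<Rightarrow> nat \<Rightarrow> nat multiset \<Rightarrow> nat multiset" where
  "shift m q \<mu> = from_mults m (mults m \<mu> @ [0])"

definition jump :: "nat \<Rightarrow> nat \<Rightarrow> nat multiset \<Rightarrow> nat multiset" where
  "jump m q \<mu> =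
    (let as = mults m \<mu>; t = (THE t. sum_list as = q ^ t)
     in from_mults m (butlast as @ [last as + (q ^ (t + 1) - q ^ t)]))"

text \<open>Sequences of operators are sequences of symbols; the rightmost one is applied first.\<close>

datatype operator = Raise | Migration | Shift | Jump

primrec apply_operator :: "nat \<Rightarrow> nat \<Rightarrow> operator \<Rightarrow> nat multiset \<Rightarrow> nat multiset" where
  "apply_operator m q Raise = raise m q"
| "apply_operator m q Migration = migration m q"
| "apply_operator m q Shift = shift m q"
| "apply_operator m q Jump = jump m q"

definition apply_operators :: "nat \<Rightarrow> nat \<Rightarrow> operator list \<Rightarrow> nat multiset \<Rightarrow> nat multiset" where
  "apply_operators m q w = foldr (apply_operator m q) w"

end

theory Submission
  imports Defs
begin

text \<open>
  A conjugate \<open>(m, q)\<close>-ary partition \<open>(a\<^sub>k, \<dots>, a\<^sub>0)\<^sub>m\<close> is determined by its partial sums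
  \<open>a\<^sub>k, a\<^sub>k + a\<^sub>k\<^sub>-\<^sub>1, \<dots>\<close>, and these are powers of \<open>q\<close>, because \<open>a\<^sub>k + \<dots> + a\<^sub>r\<close> counts the parts
  that are at least \<open>m ^ r\<close>: it is the length of a column of the Ferrers diagram, that is, a part of
  the conjugate (lemma \<open>conjugate_ary_is_exponent_partition\<close>). So the partition is encoded by the
  nonempty weakly increasing list of exponents of its partial sums, and in this encoding the
  operators lose all arithmetic: raise adds 1 to every exponent, migration puts a 0 in front, shift
  repeats the last exponent, and jump adds 1 to the last exponent
  (lemma \<open>apply_operator_exponent_partition\<close>). The trivial partition becomes
  the list \<open>[0]\<close>.

  On weakly increasing lists both claims are evident by looking at one end of the list. A list
  other than \<open>[0]\<close> comes from a migration if its head is 0 and from a raise otherwise (then all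
  exponents are positive). It comes from a shift if its last two entries agree, and from a
  jump otherwise. The predecessor is unique in each case, and each operator adds 1 to the sum of
  the length and the last entry, so the descent ends at \<open>[0]\<close>.
\<close>

section \<open>Objects generated by unique words\<close>

text \<open>Undoing the leftmost letter is a deterministic, terminating procedure; the letters that it
  undoes spell the word.\<close>

lemma unique_generating_word:
  fixes act :: "'o \<Rightarrow> 'a \<Rightarrow> 'a" and rank :: "'a \<Rightarrow> nat"
  assumes closed: "a \<in> X" "\<And>f x. f \<in> F \<Longrightarrow> x \<in> X \<Longrightarrow> act f x \<in> X"
    and start: "\<And>f x. f \<in> F \<Longrightarrow> x \<in> X \<Longrightarrow> act f x \<noteq> a"
    and inj: "\<And>f g x y. f \<in> F \<Longrightarrow> g \<in> F \<Longrightarrow> x \<in> X \<Longrightarrow> y \<in> X \<Longrightarrow> act f x = act g y \<Longrightarrow> f = g \<and> x = y"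
    and surj: "\<And>x. x \<in> X \<Longrightarrow> x \<noteq> a \<Longrightarrow> \<exists>f\<in>F. \<exists>y\<in>X. x = act f y"
    and rank: "\<And>f x. f \<in> F \<Longrightarrow> x \<in> X \<Longrightarrow> rank x < rank (act f x)"
    and "x \<in> X"
  shows "\<exists>!w. w \<in> lists F \<and> foldr act w a = x"
proof -
  have mem: "foldr act w a \<in> X" if "w \<in> lists F" for w
    using that by (induction w) (auto intro: closed)
  have ex: "\<exists>w. w \<in> lists F \<and> foldr act w a = x"
    using \<open>x \<in> X\<close>
  proof (induction "rank x" arbitrary: x rule: less_induct)
    case less
    show ?case
    proof (cases "x = a")
      case True
      then show ?thesis by (intro exI[of _ "[]"]) simp
    next
      case False
      with surj less.prems obtain f y where y: "f \<in> F" "y \<in> X" "x = act f y" by blast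
      with less.hyps[of y] rank obtain w where "w \<in> lists F" "foldr act w a = y" by blast
      with y show ?thesis by (intro exI[of _ "f # w"]) simp
    qed
  qed
  have uniq: "w = v" if "w \<in> lists F" "v \<in> lists F" "foldr act w a = foldr act v a" for w v
    using that
  proof (induction w arbitrary: v rule: list.induct)
    case Nil
    show ?case
    proof (cases v)
      case (Cons g u)
      with Nil.prems start[of g "foldr act u a"] mem[of u] show ?thesis by simp
    qed simp
  next
    case (Cons f w)
    show ?case
    proof (cases v)
      case Nil
      with Cons.prems start[of f "foldr act w a"] mem[of w] show ?thesis by simp
    next
      case v: (Cons g u)
      with Cons.prems have "f = g \<and> foldr act w a = foldr act u a"
        by (intro inj mem) auto
      with Cons.IH[of u] Cons.prems v show ?thesis by simp
    qed
  qed
  from ex uniq show ?thesis by blast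
qed


section \<open>The operators on lists of exponents\<close>

definition exponent_lists :: "nat list set" where
  "exponent_lists = {ts. ts \<noteq> [] \<and> sorted ts}"

lemma start_in_exponent_lists: "[0] \<in> exponent_lists"
  by (simp add: exponent_lists_def)

primrec exponent_step :: "operator \<Rightarrow> nat list \<Rightarrow> nat list" where
  "exponent_step Raise ts = map Suc ts"
| "exponent_step Migration ts = 0 # ts"
| "exponent_step Shift ts = ts @ [last ts]"
| "exponent_step Jump ts = butlast ts @ [Suc (last ts)]"

lemma exponent_step_closed:
  assumes "ts \<in> exponent_lists"
  shows "exponent_step f ts \<in> exponent_lists"
proof -
  from assms obtain us t where "ts = us @ [t]" "sorted (us @ [t])"
    unfolding exponent_lists_def by (cases ts rule: rev_cases) auto
  then show ?thesis
    by (cases f) (auto simp: exponent_lists_def sorted_append sorted_map intro: le_SucI)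
qed

lemma foldr_exponent_step_mem: "foldr exponent_step w [0] \<in> exponent_lists"
  by (induction w) (simp_all add: start_in_exponent_lists exponent_step_closed)

lemma rank_exponent_step:
  assumes "ts \<in> exponent_lists"
  shows "length (exponent_step f ts) + last (exponent_step f ts) = Suc (length ts + last ts)"
  using assms by (cases f) (auto simp: exponent_lists_def last_map)

lemma exponent_step_neq_start:
  assumes "ts \<in> exponent_lists"
  shows "exponent_step f ts \<noteq> [0]"
  using assms rank_exponent_step[OF assms, of f] by (auto simp: exponent_lists_def)

text \<open>The head decides the last operator: it is 0 after a migration and positive after a raise.\<close>

lemma unique_raise_migration_word:
  assumes "ts \<in> exponent_lists"
  shows "\<exists>!w. w \<in> lists {Raise, Migration} \<and> foldr exponent_step w [0] = ts"
proof (rule unique_generating_word[where X = exponent_lists and rank = "\<lambda>ts. length ts + last ts"])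
  fix f g ts us
  assume "f \<in> {Raise, Migration}" "g \<in> {Raise, Migration}"
    and "ts \<in> exponent_lists" "us \<in> exponent_lists" "exponent_step f ts = exponent_step g us"
  then show "f = g \<and> ts = us"
    by (auto simp: exponent_lists_def inj_map_eq_map Cons_eq_map_conv map_eq_Cons_conv)
next
  fix ts assume ts: "ts \<in> exponent_lists" "ts \<noteq> [0]"
  show "\<exists>f\<in>{Raise, Migration}. \<exists>us\<in>exponent_lists. ts = exponent_step f us"
  proof (cases "hd ts = 0")
    case True
    with ts have "ts = exponent_step Migration (tl ts)" "tl ts \<in> exponent_lists"
      by (cases ts; auto simp: exponent_lists_def)+
    then show ?thesis by blast
  next
    case False
    with ts have pos: "\<forall>t\<in>set ts. 0 < t"
      by (cases ts) (auto simp: exponent_lists_def)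
    have "ts = exponent_step Raise (map (\<lambda>t. t - 1) ts)"
      using pos by (simp add: map_idI)
    moreover have "map (\<lambda>t. t - 1) ts \<in> exponent_lists"
      using ts by (auto simp: exponent_lists_def intro!: sorted_map_mono mono_onI)
    ultimately show ?thesis by blast
  qed
qed (use assms in \<open>auto simp: rank_exponent_step exponent_step_closed exponent_step_neq_start
      start_in_exponent_lists simp del: exponent_step.simps\<close>)

text \<open>The end of the list decides the last operator: after a shift the last two entries agree,
  while after a jump the last entry exceeds all others, because the list was weakly increasing.\<close>

lemma unique_shift_jump_word:
  assumes "ts \<in> exponent_lists"
  shows "\<exists>!w. w \<in> lists {Shift, Jump} \<and> foldr exponent_step w [0] = ts"
proof (rule unique_generating_word[where X = exponent_lists and rank = "\<lambda>ts. length ts + last ts"])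
  fix f g ts us
  assume fg: "f \<in> {Shift, Jump}" "g \<in> {Shift, Jump}"
    and ts: "ts \<in> exponent_lists" and us: "us \<in> exponent_lists"
    and eq: "exponent_step f ts = exponent_step g us"
  from ts obtain ts' t where ts': "ts = ts' @ [t]" "sorted (ts' @ [t])"
    unfolding exponent_lists_def by (cases ts rule: rev_cases) auto
  from us obtain us' u where us': "us = us' @ [u]" "sorted (us' @ [u])"
    unfolding exponent_lists_def by (cases us rule: rev_cases) auto
  from fg eq show "f = g \<and> ts = us"
    using ts'(2) us'(2) unfolding ts'(1) us'(1) by (auto simp: sorted_append)
next
  fix ts assume ts: "ts \<in> exponent_lists" "ts \<noteq> [0]"
  then obtain us t where us: "ts = us @ [t]" "sorted us" "\<forall>u\<in>set us. u \<le> t"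
    unfolding exponent_lists_def by (cases ts rule: rev_cases) (auto simp: sorted_append)
  show "\<exists>f\<in>{Shift, Jump}. \<exists>us\<in>exponent_lists. ts = exponent_step f us"
  proof (cases "us \<noteq> [] \<and> last us = t")
    case True
    with us have "ts = exponent_step Shift us" "us \<in> exponent_lists"
      by (auto simp: exponent_lists_def)
    then show ?thesis by blast
  next
    case False
    have lt: "\<forall>u\<in>set us. u < t"
    proof (cases us rule: rev_cases)
      case (snoc vs v)
      with us False show ?thesis by (force simp: sorted_append)
    qed simp
    have "0 < t"
      using ts us lt by (cases us) auto
    with us lt have "ts = exponent_step Jump (us @ [t - 1])" "us @ [t - 1] \<in> exponent_lists"
      by (auto simp: exponent_lists_def sorted_append)
    then show ?thesis by blast
  qed
qed (use assms in \<open>auto simp: rank_exponent_step exponent_step_closed exponent_step_neq_start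
      start_in_exponent_lists simp del: exponent_step.simps\<close>)


section \<open>Lists of increments\<close>

primrec increments :: "nat \<Rightarrow> nat list \<Rightarrow> nat list" where
  "increments c [] = []"
| "increments c (x # xs) = (x - c) # increments x xs"

lemma increments_append:
  "increments c (xs @ [x]) = increments c xs @ [x - last (c # xs)]"
  by (induction xs arbitrary: c) auto

lemma increments_mult: "increments (q * c) (map ((*) q) xs) = map ((*) q) (increments c xs)"
  by (induction xs arbitrary: c) (auto simp: diff_mult_distrib2)

lemma sum_list_increments: "sorted (c # xs) \<Longrightarrow> c + sum_list (increments c xs) = last (c # xs)"
  by (induction xs arbitrary: c) fastforce+

lemma increments_inject:
  "increments c xs = increments c ys \<Longrightarrow> sorted (c # xs) \<Longrightarrow> sorted (c # ys) \<Longrightarrow> xs = ys"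
proof (induction xs arbitrary: c ys)
  case Nil
  then show ?case by (cases ys) auto
next
  case (Cons x xs)
  then obtain y zs where ys: "ys = y # zs" by (cases ys) auto
  with Cons.prems have "x = y" by auto
  with Cons ys show ?case by auto
qed

lemma increments_map_rev_upt:
  "increments (s n) (map s (rev [0..<n])) = map (\<lambda>i. s i - s (Suc i)) (rev [0..<n])"
  by (induction n) auto


section \<open>Partitions from lists of exponents\<close>

lemma mults_from_mults:
  assumes "m \<ge> 2" and "as \<noteq> []" and "hd as \<noteq> 0"
  shows "mults m (from_mults m as) = as"
proof -
  define n where "n = length as - 1"
  define f where "f = (!) (rev as)"
  have len: "length as = Suc n" using assms(2) by (simp add: n_def)
  have "map f [0..<Suc n] = rev as"
    unfolding f_def by (metis len length_rev map_nth)
  then have as: "as = map f (rev [0..<Suc n])"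
    by (metis rev_map rev_rev_ident)
  have inj: "m ^ i = m ^ j \<longleftrightarrow> i = j" for i j
    using assms(1) by simp
  have count: "count (from_mults m as) (m ^ i) = (if i < Suc n then f i else 0)" for i
    by (subst as, subst count_from_mults_map[OF assms(1)])
      (simp add: inj sum.delta' del: sum.lessThan_Suc)
  have "f n \<noteq> 0" using as assms(3) by (metis f_def hd_conv_nth last_conv_nth
        len length_rev diff_Suc_1 hd_rev rev_rev_ident rev_is_Nil_conv assms(2))
  then have "Max {i. m ^ i \<in># from_mults m as} = n"
    by (intro Max_eqI) (auto simp: count_greater_zero_iff[symmetric] count split: if_splits
        simp del: count_greater_zero_iff intro: finite_subset[of _ "{..n}"])
  then have "mults m (from_mults m as) = map f (rev [0..<Suc n])"
    unfolding mults_def by (auto simp: count)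
  with as show ?thesis by simp
qed

text \<open>Multiplicities are the differences of consecutive partial sums; the start value 0 makes the
  first multiplicity equal to the first partial sum.\<close>

definition exponent_mults :: "nat \<Rightarrow> nat list \<Rightarrow> nat list" where
  "exponent_mults q ts = increments 0 (map ((^) q) ts)"

definition exponent_partition :: "nat \<Rightarrow> nat \<Rightarrow> nat list \<Rightarrow> nat multiset" where
  "exponent_partition m q ts = from_mults m (exponent_mults q ts)"

context
  fixes m q :: nat
  assumes m: "m \<ge> 2" and q: "q \<ge> 2"
begin

lemma sorted_powers:
  assumes "ts \<in> exponent_lists"
  shows "sorted (0 # map ((^) q) ts)"
  using assms q
  by (auto simp: exponent_lists_def power_increasing intro!: sorted_map_mono mono_onI)

lemma mults_exponent_partition:
  assumes "ts \<in> exponent_lists"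
  shows "mults m (exponent_partition m q ts) = exponent_mults q ts"
  unfolding exponent_partition_def using assms q
  by (intro mults_from_mults m) (cases ts; simp add: exponent_lists_def exponent_mults_def)+

lemma exponent_partition_inject:
  assumes "ts \<in> exponent_lists" "us \<in> exponent_lists"
    and "exponent_partition m q ts = exponent_partition m q us"
  shows "ts = us"
proof -
  have "exponent_mults q ts = exponent_mults q us"
    using assms by (metis mults_exponent_partition)
  then have "map ((^) q) ts = map ((^) q) us"
    unfolding exponent_mults_def
    by (rule increments_inject[OF _ assms(1,2)[THEN sorted_powers]])
  moreover have "inj ((^) q)"
    using q by (simp add: inj_def)
  ultimately show ?thesis by (simp add: inj_map_eq_map)
qed

text \<open>On partial sums, raise multiplies everything by \<open>q\<close>, migration splits the first one as
  \<open>1 + (q ^ t - 1)\<close>, shift adds a zero increment, and jump changes only the total, from \<open>q ^ t\<close> to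
  \<open>q ^ (t + 1)\<close>.\<close>

lemma apply_operator_exponent_partition:
  assumes ts: "ts \<in> exponent_lists"
  shows "apply_operator m q f (exponent_partition m q ts)
    = exponent_partition m q (exponent_step f ts)"
proof -
  from ts obtain us t where us: "ts = us @ [t]"
    unfolding exponent_lists_def by (cases ts rule: rev_cases) auto
  \<comment> \<open>the last partial sum but one, or 0 if there is only one\<close>
  define z where "z = last (0 # map ((^) q) us)"
  have mults: "exponent_mults q (us @ [x]) = exponent_mults q us @ [q ^ x - z]" for x
    by (simp add: exponent_mults_def increments_append z_def)
  show ?thesis
  proof (cases f)
    case Raise
    have "exponent_mults q (map Suc ts) = map ((*) q) (exponent_mults q ts)"
      using increments_mult[of q 0 "map ((^) q) ts"]
      by (simp add: exponent_mults_def comp_def)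
    then show ?thesis
      by (simp add: Raise raise_def mults_exponent_partition[OF ts])
        (simp add: exponent_partition_def)
  next
    case Migration
    have "exponent_mults q (0 # ts)
        = 1 # (hd (exponent_mults q ts) - 1) # tl (exponent_mults q ts)"
      by (cases ts) (use us in \<open>auto simp: exponent_mults_def\<close>)
    then show ?thesis
      by (simp add: Migration migration_def Let_def mults_exponent_partition[OF ts])
        (simp add: exponent_partition_def)
  next
    case Shift
    have "exponent_mults q (ts @ [last ts]) = exponent_mults q ts @ [0]"
      using increments_append[of 0 "map ((^) q) ts" "q ^ t"] us
      by (simp add: exponent_mults_def last_map)
    then show ?thesis
      by (simp add: Shift shift_def mults_exponent_partition[OF ts])
        (simp add: exponent_partition_def)
  next
    case Jump
    have "sum_list (exponent_mults q ts) = q ^ t"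
      using sum_list_increments[OF sorted_powers[OF ts]] by (simp add: exponent_mults_def us)
    then have the: "(THE i. sum_list (exponent_mults q ts) = q ^ i) = t"
      using q by auto
    have "z \<le> q ^ t"
      using sorted_powers[OF ts]
      by (cases us rule: rev_cases) (auto simp: us z_def sorted_append)
    moreover have "q ^ t \<le> q ^ (t + 1)"
      using q by simp
    ultimately have "(q ^ t - z) + (q ^ (t + 1) - q ^ t) = q ^ Suc t - z"
      by simp
    then have "exponent_mults q (butlast ts @ [Suc (last ts)])
        = butlast (exponent_mults q ts) @ [last (exponent_mults q ts) + (q ^ (t + 1) - q ^ t)]"
      by (simp add: us mults)
    then show ?thesis
      by (simp add: Jump jump_def Let_def mults_exponent_partition[OF ts] the)
        (simp add: exponent_partition_def)
  qed
qed

lemma apply_operators_start: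
  "apply_operators m q w (from_mults m [1]) = exponent_partition m q (foldr exponent_step w [0])"
proof -
  have "from_mults m [1] = exponent_partition m q [0]"
    by (simp add: exponent_partition_def exponent_mults_def)
  then show ?thesis
    unfolding apply_operators_def
    by (induction w) (simp_all add: apply_operator_exponent_partition foldr_exponent_step_mem)
qed

end


section \<open>Conjugate-ary partitions come from lists of exponents\<close>

text \<open>Column \<open>j\<close> of the Ferrers diagram, counted from 0, meets exactly the rows longer than \<open>j\<close>;
  the part \<open>p\<close> is such a row, so the column is not empty.\<close>

lemma column_length_in_conjugate:
  assumes "p \<in># \<mu>" and "j < p"
  shows "size (filter_mset (\<lambda>p. j < p) \<mu>) \<in># conjugate \<mu>"
proof -
  define xs where "xs = rev (sorted_list_of_multiset \<mu>)"
  have mset: "mset xs = \<mu>" by (simp add: xs_def)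
  have len: "length xs = size \<mu>" by (metis mset size_mset)
  have F: "ferrers \<mu> = {(i, j). i < length xs \<and> j < xs ! i}"
    by (simp add: ferrers_def xs_def[symmetric] len)
  have "ferrers \<mu> = (SIGMA i:{..<length xs}. {..<xs ! i})"
    by (auto simp: F)
  then have fin: "finite (ferrers \<mu>)" by simp
  have "p \<in> set xs" using assms(1) mset by auto
  then have dom: "j \<in> Domain ((ferrers \<mu>)\<inverse>)"
    using assms(2) by (auto simp: F in_set_conv_nth)
  have "(ferrers \<mu>)\<inverse> `` {j} = {i. i < length xs \<and> j < xs ! i}"
    by (auto simp: F)
  then have "card ((ferrers \<mu>)\<inverse> `` {j}) = length (filter (\<lambda>p. j < p) xs)"
    by (simp add: length_filter_conv_card)
  also have "\<dots> = size (filter_mset (\<lambda>p. j < p) \<mu>)"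
    by (metis mset mset_filter size_mset)
  finally have "size (filter_mset (\<lambda>p. j < p) \<mu>) = card ((ferrers \<mu>)\<inverse> `` {j})" by simp
  moreover have "finite (Domain ((ferrers \<mu>)\<inverse>))"
    using fin by (simp add: finite_Range)
  ultimately show ?thesis
    using dom by (auto simp: conjugate_def row_lengths_def)
qed

text \<open>The partial sum of the multiplicities down to that of \<open>m ^ r\<close> is the length of column
  \<open>m ^ r - 1\<close>. For \<open>r \<le> k\<close> the largest part \<open>m ^ k\<close> meets this column, so the sum is a part of the
  conjugate.\<close>

lemma conjugate_ary_is_exponent_partition:
  assumes m: "m \<ge> 2" and q: "q \<ge> 2" and ca: "conjugate_ary m q \<mu>"
  shows "\<exists>ts\<in>exponent_lists. \<mu> = exponent_partition m q ts"
proof -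
  from ca have ary: "ary m \<mu>" "ary q (conjugate \<mu>)" by (auto simp: conjugate_ary_def)
  have inj: "m ^ i = m ^ j \<longleftrightarrow> i = j" for i j
    using m by simp
  define K where "K = {i. m ^ i \<in># \<mu>}"
  define k where "k = Max K"
  have "finite ((\<lambda>i. m ^ i) -` set_mset \<mu>)"
    by (rule finite_vimageI) (auto simp: inj_def inj)
  then have fin: "finite K"
    by (simp add: vimage_def K_def)
  have "\<mu> \<noteq> {#}" using ary(1) by (auto simp: ary_def partition_of_def)
  with ary(1) have "K \<noteq> {}" by (fastforce simp: ary_def K_def)
  with fin have top: "m ^ k \<in># \<mu>"
    using Max_in unfolding k_def K_def by blast
  have le_k: "i \<le> k" if "m ^ i \<in># \<mu>" for i
    unfolding k_def using fin that by (intro Max_ge) (auto simp: K_def)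
  have part: "\<exists>i\<le>k. p = m ^ i" if "p \<in># \<mu>" for p
    using that ary(1) le_k unfolding ary_def by metis
  \<comment> \<open>\<open>s r\<close> is the partial sum of the multiplicities of \<open>m ^ k, \<dots>, m ^ r\<close>.\<close>
  define s where "s r = size (filter_mset (\<lambda>p. m ^ r \<le> p) \<mu>)" for r
  have le: "m ^ r \<le> m ^ i \<longleftrightarrow> r \<le> i" for r i
    using m by simp
  have s_zero: "s (Suc k) = 0"
  proof -
    have "\<not> m ^ Suc k \<le> p" if "p \<in># \<mu>" for p
      using part[OF that] le by (metis Suc_n_not_le_n le_trans)
    then show ?thesis
      by (simp add: s_def filter_mset_eq_mempty_iff del: power_Suc)
  qed
  have s_Suc: "s i - s (Suc i) = count \<mu> (m ^ i)" for i
  proof -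
    have "filter_mset (\<lambda>p. m ^ i \<le> p) \<mu>
        = filter_mset (\<lambda>p. m ^ Suc i \<le> p) \<mu> + filter_mset (\<lambda>p. p = m ^ i) \<mu>"
    proof (rule multiset_eqI)
      fix p
      show "count (filter_mset (\<lambda>p. m ^ i \<le> p) \<mu>) p
          = count (filter_mset (\<lambda>p. m ^ Suc i \<le> p) \<mu> + filter_mset (\<lambda>p. p = m ^ i) \<mu>) p"
      proof (cases "p \<in># \<mu>")
        case True
        with part obtain j where "p = m ^ j" by blast
        then show ?thesis by (auto simp: le inj simp del: power_Suc)
      next
        case False
        then show ?thesis by (auto simp: not_in_iff)
      qed
    qed
    then show ?thesis
      by (simp add: s_def filter_eq_replicate_mset del: power_Suc)
  qed
  have s_mono: "s j \<le> s i" if "i \<le> j" for i j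
  proof -
    have "m ^ i \<le> m ^ j" using m that by (simp add: power_increasing)
    then show ?thesis
      unfolding s_def by (intro size_mset_mono) (auto simp: subseteq_mset_def)
  qed
  have "\<exists>t. s r = q ^ t" if "r \<le> k" for r
  proof -
    have column: "m ^ r - 1 < p \<longleftrightarrow> m ^ r \<le> p" for p
      using m by (simp add: Suc_le_eq[symmetric])
    have "s r \<in># conjugate \<mu>"
      using column_length_in_conjugate[OF top, of "m ^ r - 1"] that
      unfolding column s_def le by blast
    with ary(2) show ?thesis by (simp add: ary_def)
  qed
  then obtain t where t: "s r = q ^ t r" if "r \<le> k" for r
    by metis
  define ts where "ts = map t (rev [0..<Suc k])"
  have t_mono: "t j \<le> t i" if "i \<le> j" "j \<le> k" for i j
    using s_mono[OF that(1)] t[of i] t[of j] that q by simp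
  have "sorted ts"
    unfolding ts_def by (auto simp: sorted_iff_nth_mono rev_nth simp del: upt_Suc intro!: t_mono)
  then have mem: "ts \<in> exponent_lists"
    by (simp add: exponent_lists_def ts_def)
  have "map ((^) q) ts = map s (rev [0..<Suc k])"
    unfolding ts_def using t by (auto simp: less_Suc_eq_le)
  then have "exponent_mults q ts = increments (s (Suc k)) (map s (rev [0..<Suc k]))"
    by (simp add: exponent_mults_def s_zero)
  also have "\<dots> = mults m \<mu>"
    unfolding increments_map_rev_upt s_Suc mults_def k_def K_def ..
  finally have "\<mu> = exponent_partition m q ts"
    using from_mults_mults[OF m ary(1)] by (simp add: exponent_partition_def)
  with mem show ?thesis by blast
qed


section \<open>Generation by unique sequences of operators\<close>

theorem theorem2p7:
  fixes m q :: nat and \<mu> :: "nat multiset"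
  assumes "m \<ge> 2" and "q \<ge> 2"
    and "conjugate_ary m q \<mu>"
  shows "(\<exists>!w. w \<in> lists {Raise, Migration} \<and> apply_operators m q w (from_mults m [1]) = \<mu>)
       \<and> (\<exists>!w. w \<in> lists {Shift, Jump} \<and> apply_operators m q w (from_mults m [1]) = \<mu>)"
proof -
  obtain ts where ts: "ts \<in> exponent_lists" "\<mu> = exponent_partition m q ts"
    using conjugate_ary_is_exponent_partition assms by blast
  have "apply_operators m q w (from_mults m [1]) = \<mu> \<longleftrightarrow> foldr exponent_step w [0] = ts" for w
    unfolding apply_operators_start[OF assms(1,2)] ts(2)
    using exponent_partition_inject[OF assms(1,2) foldr_exponent_step_mem ts(1)] by auto
  then show ?thesis
    using unique_raise_migration_word[OF ts(1)] unique_shift_jump_word[OF ts(1)] by simp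
qed

end
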